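(* Let $a\in(0,1)$, let $p=(p_1,\ldots,p_m)$ be a probability vector with $m\ge 2$ and all $p_i>0$, and let $t=(t_1,\ldots,t_m)\in\mathbb{R}^m$ with $t_1=0$, $t_2=1$. There is a constant $C_a>0$ depending only on $a$ such that the following holds. For each $\varepsilon>0$ small enough (for given $p$, the smallness threshold can be taken to depend continuously on $a$), for all $T$ large enough, the set of frequencies \[ \{u\in[-T,T] : |\widehat{\mu}_{a,t}^p(u)|\ge T^{-\varepsilon}\} \] can be covered by $C_aT^{\delta}$ intervals of length $1$, where \[ \delta=\frac{\log\left(\lceil 1+1/a\rceil\right)\tilde{\varepsilon}+h(\tilde{\varepsilon})}{\log(1/a)},\qquad \tilde{\varepsilon}=\frac{\log(a)}{\log\left(1-\eta\left(\tfrac{a}{a+1},p\right)\right)}\,\varepsilon . \]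
   Context: $\mu_{a,t}^p$ denotes the homogeneous self-similar measure for the iterated function system $\{ax+t_i\}_{i=1}^m$ with weights $p$, that is, the distribution of the random sum $\sum_{n=1}^\infty X_na^n$, where the $X_n$ are independent and identically distributed with $\mathbb{P}(X_n=t_i)=p_i$. The Fourier transform of a finite Borel measure $\mu$ on $\mathbb{R}$ is $\widehat{\mu}(\xi)=\int e^{2\pi i\xi x}\,d\mu(x)$. For $c\in(0,1)$, \[ \eta(c,p)=p_1+p_2-\sqrt{p_1^2+2p_1p_2\cos(\pi c)+p_2^2}. \] The entropy function is $h(x)=-x\log x-(1-x)\log(1-x)$ for $x\in(0,1)$ (natural logarithm), and $\lceil\cdot\rceil$ is the ceiling function. *)

theory Defs
  imports "HOL-Probability.Probability"
begin

text \<open>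
  Weights and translations are functions on \<open>{1..m}\<close>; their values elsewhere are never used.
\<close>

definition prob_vector :: "nat \<Rightarrow> (nat \<Rightarrow> real) \<Rightarrow> bool" where
  "prob_vector m p \<longleftrightarrow> (\<forall>i\<in>{1..m}. p i \<ge> 0) \<and> (\<Sum>i=1..m. p i) = 1"

text \<open>
  The underlying probability space is the countable power of \<open>{1..m}\<close> with weights \<open>p\<close>. The
  random variable called $X_{n+1}$ in the usual notation is \<open>\<lambda>\<omega>. t (\<omega> n)\<close>, so that the random
  sum $\sum_{n \ge 1} X_n a^n$ starts with exponent 1. Drawing indices rather than values
  means that weights of coinciding \<open>t i\<close> add up.
\<close>

definition self_similar_measure ::
    "real \<Rightarrow> nat \<Rightarrow> (nat \<Rightarrow> real) \<Rightarrow> (nat \<Rightarrow> real) \<Rightarrow> real measure" where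
  "self_similar_measure a m p t =
     distr (PiM UNIV (\<lambda>_::nat. point_measure {1..m} (\<lambda>i. ennreal (p i)))) borel
       (\<lambda>\<omega>. \<Sum>n. t (\<omega> n) * a ^ Suc n)"

text \<open>This normalisation is related to the library's by \<open>fourier \<mu> \<xi> = char \<mu> (2 * pi * \<xi>)\<close>.\<close>

definition fourier :: "real measure \<Rightarrow> real \<Rightarrow> complex" where
  "fourier \<mu> \<xi> = (CLINT x|\<mu>. iexp (2 * pi * \<xi> * x))"

definition eta :: "real \<Rightarrow> (nat \<Rightarrow> real) \<Rightarrow> real" where
  "eta c p = p 1 + p 2 - sqrt ((p 1)\<^sup>2 + 2 * p 1 * p 2 * cos (pi * c) + (p 2)\<^sup>2)"

definition entropy_fun :: "real \<Rightarrow> real" where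
  "entropy_fun x = - x * ln x - (1 - x) * ln (1 - x)"

definition eps_tilde :: "real \<Rightarrow> (nat \<Rightarrow> real) \<Rightarrow> real \<Rightarrow> real" where
  "eps_tilde a p \<epsilon> = ln a / ln (1 - eta (a / (a + 1)) p) * \<epsilon>"

definition cover_exponent :: "real \<Rightarrow> (nat \<Rightarrow> real) \<Rightarrow> real \<Rightarrow> real" where
  "cover_exponent a p \<epsilon> =
     (ln (of_int \<lceil>1 + 1 / a\<rceil>) * eps_tilde a p \<epsilon> + entropy_fun (eps_tilde a p \<epsilon>)) / ln (1 / a)"

text \<open>The bound \<open>b\<close> on the number of intervals need not be an integer.\<close>

definition covered_by_unit_intervals :: "real set \<Rightarrow> real \<Rightarrow> bool" where
  "covered_by_unit_intervals S b \<longleftrightarrow>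
     (\<exists>\<I>. finite \<I> \<and> (\<forall>I\<in>\<I>. \<exists>x. I = {x..x + 1}) \<and> real (card \<I>) \<le> b \<and> S \<subseteq> \<Union>\<I>)"

end

theory Submission imports Defs begin

text \<open>
  The proof is an Erdos--Kahane counting argument. Since the measure \<open>\<mu>\<close> is self-similar,
  \<open>fourier \<mu> u\<close> is the product of \<open>\<Phi> (a u)\<close> and \<open>fourier \<mu> (a u)\<close>, where \<open>\<Phi>\<close>
  (\<open>digit_fourier\<close> below) is the Fourier transform of a single digit. Hence \<open>fourier \<mu> u\<close> is
  bounded by the product of \<open>\<Phi>\<close> over the \<open>N\<close> scales \<open>a u, a^2 u, ..., a^N u\<close>. The digits 0
  and 1 both occur, so \<open>\<Phi> x\<close> has modulus at most \<open>\<rho> = 1 - eta c p\<close> whenever \<open>x\<close> lies at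
  distance at least \<open>c / 2\<close> from the integers. Call a scale bad for \<open>u\<close> if this happens there. A
  frequency at which the transform is at least \<open>T powr (- \<epsilon>)\<close> has at most
  \<open>\<epsilon> ln T / - ln \<rho>\<close> bad scales (\<open>few_bad_scales\<close>). With \<open>L = ln T / ln (1 / a)\<close> this is
  \<open>eps_tilde a p \<epsilon> * L\<close>, and \<open>N = \<lceil>L\<rceil>\<close> scales bring \<open>[-T, T]\<close> into \<open>[-1, 1]\<close>.

  It remains to count the frequencies with a prescribed set \<open>A\<close> of bad scales
  (\<open>frequencies_with_bad_scales_covered\<close>). Cover the possible values of \<open>a^N u\<close>, then those of
  \<open>a^(N-1) u\<close>, and so on up to \<open>u\<close>, always by intervals of length \<open>l = 1 / (a + 1)\<close>. For
  \<open>c = a / (a + 1)\<close> the two relations \<open>c + l = 1\<close> and \<open>c = a l\<close> hold. The first says that an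
  interval of length \<open>l\<close> meets only one of the open intervals of length \<open>c\<close> around the integers;
  the second says that this one is stretched by \<open>1 / a\<close> to length \<open>l\<close> again. So a good scale does
  not increase the number of intervals. At a bad scale the whole interval is stretched, and
  \<open>\<lceil>1 + 1 / a\<rceil>\<close> new intervals suffice. In this way the cost of a bad scale is paid once, although
  a bad scale \<open>n\<close> affects both the passage into \<open>n\<close> and the one out of it.

  Finally the number of sets of at most \<open>q N\<close> among \<open>N\<close> scales is at most
  \<open>exp (N h(q))\<close> for \<open>q \<le> 1 / 2\<close> (\<open>card_small_subsets_le_entropy\<close>), which accounts for the
  entropy in the exponent; the smallness threshold on \<open>\<epsilon>\<close> is exactly the condition
  \<open>eps_tilde a p \<epsilon> < 1 / 2\<close>. The constant can be taken to be \<open>4 * exp 1\<close> for every \<open>a\<close>: the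
  factor 4 covers \<open>[-1, 1]\<close>, and \<open>exp 1\<close> pays for rounding \<open>L\<close> up to \<open>N\<close>.
\<close>

section \<open>Covering by intervals of a fixed length\<close>

definition covered_by_length :: "real \<Rightarrow> real set \<Rightarrow> real \<Rightarrow> bool" where
  "covered_by_length l S b \<longleftrightarrow>
     (\<exists>F. finite F \<and> real (card F) \<le> b \<and> S \<subseteq> (\<Union>x\<in>F. {x..x + l}))"

lemma covered_by_length_UN:
  assumes "finite I" and "\<And>i. i \<in> I \<Longrightarrow> covered_by_length l (S i) (b i)"
  shows "covered_by_length l (\<Union>i\<in>I. S i) (\<Sum>i\<in>I. b i)"
proof -
  obtain F where F: "\<And>i. i \<in> I \<Longrightarrow> finite (F i) \<and> real (card (F i)) \<le> b i \<and> S i \<subseteq> (\<Union>x\<in>F i. {x..x + l})"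
    using assms(2) unfolding covered_by_length_def by metis
  have "real (card (\<Union>i\<in>I. F i)) \<le> (\<Sum>i\<in>I. real (card (F i)))"
    using card_UN_le[OF assms(1), of F] by (metis of_nat_le_iff of_nat_sum)
  also have "\<dots> \<le> (\<Sum>i\<in>I. b i)"
    using F by (intro sum_mono) auto
  finally have "real (card (\<Union>i\<in>I. F i)) \<le> (\<Sum>i\<in>I. b i)" .
  moreover have "(\<Union>i\<in>I. S i) \<subseteq> (\<Union>x\<in>(\<Union>i\<in>I. F i). {x..x + l})"
    using F by fastforce
  ultimately show ?thesis
    unfolding covered_by_length_def using F assms(1)
    by (intro exI[of _ "\<Union>i\<in>I. F i"] conjI) auto
qed

lemma covered_by_length_mono:
  assumes "covered_by_length l S b" "S' \<subseteq> S" "b \<le> b'"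
  shows "covered_by_length l S' b'"
  using assms unfolding covered_by_length_def by (meson order_trans)

lemma covered_by_length_interval:
  assumes "l > 0" and "y \<le> x + real d * l"
  shows "covered_by_length l {x..<y} (real d)"
  unfolding covered_by_length_def
proof (intro exI conjI)
  let ?F = "(\<lambda>i. x + real i * l) ` {..<d}"
  show "finite ?F" by simp
  show "real (card ?F) \<le> real d"
    using card_image_le[of "{..<d}" "\<lambda>i. x + real i * l"] by simp
  show "{x..<y} \<subseteq> (\<Union>z\<in>?F. {z..z + l})"
  proof
    fix z assume z: "z \<in> {x..<y}"
    define i where "i = nat \<lfloor>(z - x) / l\<rfloor>"
    have nn: "(z - x) / l \<ge> 0" using z assms by simp
    have lo: "real i \<le> (z - x) / l" using nn unfolding i_def by simp
    have hi: "(z - x) / l < real i + 1" using nn unfolding i_def by linarith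
    have "(z - x) / l < real d" using z assms by (simp add: field_simps)
    with lo have "i < d" by linarith
    moreover have "z \<in> {x + real i * l..x + real i * l + l}"
      using lo hi assms(1) by (simp add: field_simps)
    ultimately show "z \<in> (\<Union>z\<in>?F. {z..z + l})" by blast
  qed
qed

section \<open>Frequencies with prescribed bad scales\<close>

definition near_int :: "real \<Rightarrow> real \<Rightarrow> bool" where
  "near_int c x \<longleftrightarrow> (\<exists>r::int. \<bar>x - of_int r\<bar> < c / 2)"

lemma near_int_same_integer:
  fixes y y' c :: real
  assumes "\<bar>y - of_int r\<bar> < c / 2" "\<bar>y' - of_int r'\<bar> < c / 2" "\<bar>y - y'\<bar> \<le> 1 - c"
  shows "r = r'"
proof -
  have "\<bar>real_of_int r - of_int r'\<bar> < 1" using assms by linarith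
  then show ?thesis by linarith
qed

text \<open>
  Because \<open>c + l = 1\<close>, an interval of length \<open>l\<close> cannot meet the neighbourhoods of two different
  integers: consecutive neighbourhoods are separated by a gap of length \<open>1 - c = l\<close>, and they are
  open. The one that it may meet has length \<open>c = a l\<close>, so dividing by \<open>a\<close> gives back length \<open>l\<close>.
\<close>
lemma rescaled_good_part_covered:
  fixes a c l :: real
  assumes a: "0 < a" and ca: "c = a * l" and cl: "c + l = 1"
  shows "covered_by_length l {y. a * y \<in> {x..x + l} \<and> near_int c (a * y)} 1"
proof -
  let ?S = "{y. a * y \<in> {x..x + l} \<and> near_int c (a * y)}"
  show ?thesis
  proof (cases "?S = {}")
    case True
    then show ?thesis unfolding covered_by_length_def by (intro exI[of _ "{}"]) auto
  next
    case False
    then obtain y0 r where y0: "a * y0 \<in> {x..x + l}" "\<bar>a * y0 - of_int r\<bar> < c / 2"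
      unfolding near_int_def by blast
    define z where "z = (of_int r - c / 2) / a"
    have az: "a * z = of_int r - c / 2" using a by (simp add: z_def)
    have "?S \<subseteq> {z..z + l}"
    proof
      fix y assume "y \<in> ?S"
      then obtain r' where y: "a * y \<in> {x..x + l}" "\<bar>a * y - of_int r'\<bar> < c / 2"
        unfolding near_int_def by blast
      have "\<bar>a * y - a * y0\<bar> \<le> 1 - c" using y(1) y0(1) cl unfolding atLeastAtMost_iff by linarith
      with y y0 have "r' = r" using near_int_same_integer by blast
      with y(2) have "a * z \<le> a * y" "a * y \<le> a * z + a * l"
        unfolding az ca[symmetric] by linarith+
      then have "a * z \<le> a * y" "a * y \<le> a * (z + l)" by (simp_all add: distrib_left)
      then show "y \<in> {z..z + l}" using a by simp
    qed
    then show ?thesis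
      unfolding covered_by_length_def by (intro exI[of _ "{z}"]) simp
  qed
qed

lemma rescaled_interval_covered:
  fixes a :: real
  assumes a: "0 < a" and l: "0 < l"
  shows "covered_by_length l {y. a * y \<in> {x..x + l}} (real (nat \<lceil>1 + 1 / a\<rceil>))"
proof (rule covered_by_length_mono)
  \<comment> \<open>The stretched interval is closed and has length \<open>l / a\<close>; the additional length \<open>l\<close> makes it
    fit into a half-open one.\<close>
  have "1 + 1 / a \<le> real (nat \<lceil>1 + 1 / a\<rceil>)" using a by linarith
  then have "(1 + 1 / a) * l \<le> real (nat \<lceil>1 + 1 / a\<rceil>) * l" using l by simp
  then show "covered_by_length l {x / a..<x / a + (1 + 1 / a) * l} (real (nat \<lceil>1 + 1 / a\<rceil>))"
    using l by (intro covered_by_length_interval) auto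
  show "{y. a * y \<in> {x..x + l}} \<subseteq> {x / a..<x / a + (1 + 1 / a) * l}"
  proof
    fix y assume y: "y \<in> {y. a * y \<in> {x..x + l}}"
    have "x / a \<le> y" using y a by (simp add: field_simps)
    moreover have "y \<le> (x + l) / a" using y a by (simp add: field_simps)
    moreover have "(x + l) / a < x / a + (1 + 1 / a) * l" using a l by (simp add: field_simps)
    ultimately show "y \<in> {x / a..<x / a + (1 + 1 / a) * l}" by simp
  qed
qed simp

text \<open>
  The inductive step of the count: passing from \<open>a y\<close> to \<open>y\<close> replaces each interval of the cover by
  at most \<open>k\<close> new ones. The predicate \<open>P\<close> records what is known about \<open>y\<close> at a good scale.
\<close>
lemma covered_by_length_rescale:
  assumes "covered_by_length l S b" "k \<ge> 0"
    and "\<And>x. covered_by_length l {y. a * y \<in> {x..x + l} \<and> P y} k"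
  shows "covered_by_length l {y. a * y \<in> S \<and> P y} (b * k)"
proof -
  obtain F where F: "finite F" "real (card F) \<le> b" "S \<subseteq> (\<Union>x\<in>F. {x..x + l})"
    using assms(1) unfolding covered_by_length_def by blast
  have "covered_by_length l (\<Union>x\<in>F. {y. a * y \<in> {x..x + l} \<and> P y}) (\<Sum>x\<in>F. k)"
    using F(1) assms(3) by (rule covered_by_length_UN)
  then show ?thesis
  proof (rule covered_by_length_mono)
    show "{y. a * y \<in> S \<and> P y} \<subseteq> (\<Union>x\<in>F. {y. a * y \<in> {x..x + l} \<and> P y})"
      using F(3) by blast
    show "(\<Sum>x\<in>F. k) \<le> b * k"
      using F(2) assms(2) by (simp add: mult_right_mono)
  qed
qed

text \<open>
  The scales are indexed from the coarse end: \<open>j\<close> stands for the factor \<open>a ^ (N - j)\<close>. Increasing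
  \<open>N\<close> by one then amounts to replacing \<open>u\<close> by \<open>a u\<close> at all earlier scales and appending the scale
  \<open>j = N\<close> with the factor \<open>a\<close>, so that \<open>A\<close> stays fixed during the induction.
\<close>
lemma frequencies_with_bad_scales_covered:
  fixes a c l :: real
  assumes a: "0 < a" and ca: "c = a * l" and cl: "c + l = 1" and l: "1 / 2 < l"
  shows "covered_by_length l
           {u. \<bar>a ^ N * u\<bar> \<le> 1 \<and> (\<forall>j<N. j \<notin> A \<longrightarrow> near_int c (a ^ (N - j) * u))}
           (4 * real (nat \<lceil>1 + 1 / a\<rceil>) ^ card (A \<inter> {..<N}))"
proof (induction N)
  case 0
  have "covered_by_length l {-1..<-1 + 4 * l} (real 4)"
    using l by (intro covered_by_length_interval) simp_all
  \<comment> \<open>Four intervals reach from -1 beyond 1 because \<open>l > 1 / 2\<close>.\<close>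
  then have "covered_by_length l {u. \<bar>u\<bar> \<le> 1} 4"
    by (rule covered_by_length_mono) (use l in auto)
  then show ?case by simp
next
  case (Suc N)
  let ?D = "real (nat \<lceil>1 + 1 / a\<rceil>)"
  define S where "S N = {u. \<bar>a ^ N * u\<bar> \<le> 1 \<and> (\<forall>j<N. j \<notin> A \<longrightarrow> near_int c (a ^ (N - j) * u))}" for N
  have IH: "covered_by_length l (S N) (4 * ?D ^ card (A \<inter> {..<N}))"
    using Suc.IH by (simp only: S_def)
  have S_Suc: "S (Suc N) = {y. a * y \<in> S N \<and> (N \<notin> A \<longrightarrow> near_int c (a * y))}"
  proof -
    have e: "a ^ (N - j) * (a * y) = a ^ (Suc N - j) * y" if "j \<le> N" for j y
      using that by (simp add: Suc_diff_le mult_ac)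
    have e0: "a ^ N * (a * y) = a ^ Suc N * y" for y by simp
    have "(\<forall>j<Suc N. j \<notin> A \<longrightarrow> near_int c (a ^ (Suc N - j) * y)) \<longleftrightarrow>
          (\<forall>j<N. j \<notin> A \<longrightarrow> near_int c (a ^ (N - j) * (a * y))) \<and> (N \<notin> A \<longrightarrow> near_int c (a * y))" for y
    proof -
      have "(\<forall>j<N. j \<notin> A \<longrightarrow> near_int c (a ^ (Suc N - j) * y)) \<longleftrightarrow>
            (\<forall>j<N. j \<notin> A \<longrightarrow> near_int c (a ^ (N - j) * (a * y)))"
        using e[of _ y] by (metis less_imp_le_nat)
      then show ?thesis unfolding less_Suc_eq by auto
    qed
    then show ?thesis
      unfolding S_def mem_Collect_eq e0 by blast
  qed
  have "covered_by_length l (S (Suc N)) (4 * ?D ^ card (A \<inter> {..<Suc N}))"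
  proof (cases "N \<in> A")
    case True
    have "covered_by_length l {y. a * y \<in> S N \<and> True} (4 * ?D ^ card (A \<inter> {..<N}) * ?D)"
      by (rule covered_by_length_rescale[OF IH])
        (use rescaled_interval_covered[OF a, of l] l in simp_all)
    moreover have "A \<inter> {..<Suc N} = insert N (A \<inter> {..<N})"
      using True by (auto simp: less_Suc_eq)
    ultimately show ?thesis
      unfolding S_Suc using True by (simp add: mult_ac)
  next
    case False
    have "covered_by_length l {y. a * y \<in> S N \<and> near_int c (a * y)} (4 * ?D ^ card (A \<inter> {..<N}) * 1)"
      by (rule covered_by_length_rescale[OF IH zero_le_one rescaled_good_part_covered[OF a ca cl]])
    moreover have "A \<inter> {..<Suc N} = A \<inter> {..<N}"
      using False by (auto simp: less_Suc_eq)
    ultimately show ?thesis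
      unfolding S_Suc using False by simp
  qed
  then show ?case by (simp only: S_def)
qed

section \<open>Counting small subsets\<close>

text \<open>
  Choose each element of \<open>{..<N}\<close> independently with probability \<open>q\<close>. Since \<open>q \<le> 1 - q\<close>, a set
  with at most \<open>q N\<close> elements is at least as likely as one with \<open>q N\<close> elements would be, namely
  \<open>exp (- N h(q))\<close>. The probabilities add up to at most 1.
\<close>
lemma card_small_subsets_le_entropy:
  assumes q: "0 < q" "q \<le> 1 / 2"
  shows "real (card {A. A \<subseteq> {..<N} \<and> real (card A) \<le> q * real N}) \<le> exp (real N * entropy_fun q)"
proof -
  let ?\<A> = "{A. A \<subseteq> {..<N} \<and> real (card A) \<le> q * real N}"
  \<comment> \<open>Removing an element from \<open>A\<close> multiplies its probability by \<open>(1 - q) / q \<ge> 1\<close>.\<close>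
  have ent: "exp (- (real N * entropy_fun q)) \<le> q ^ card A * (1 - q) ^ (N - card A)"
    if A: "A \<in> ?\<A>" for A
  proof -
    have cA: "card A \<le> N" using A card_mono[of "{..<N}" A] by auto
    have "ln q \<le> ln (1 - q)" using q by simp
    then have "(q * real N - real (card A)) * ln q \<le> (q * real N - real (card A)) * ln (1 - q)"
      using A by (intro mult_left_mono) auto
    then have "- (real N * entropy_fun q) \<le> real (card A) * ln q + real (N - card A) * ln (1 - q)"
      using cA unfolding entropy_fun_def by (simp add: of_nat_diff algebra_simps)
    then have "exp (- (real N * entropy_fun q))
        \<le> exp (real (card A) * ln q + real (N - card A) * ln (1 - q))" by simp
    also have "\<dots> = q ^ card A * (1 - q) ^ (N - card A)"
      using q by (simp only: exp_add exp_of_nat_mult) simp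
    finally show ?thesis .
  qed
  have "real (card ?\<A>) * exp (- (real N * entropy_fun q)) = (\<Sum>A\<in>?\<A>. exp (- (real N * entropy_fun q)))"
    by simp
  also have "\<dots> \<le> (\<Sum>A\<in>?\<A>. q ^ card A * (1 - q) ^ (N - card A))"
    by (intro sum_mono ent)
  also have "\<dots> \<le> (\<Sum>A\<in>Pow {..<N}. q ^ card A * (1 - q) ^ (N - card A))"
    using q by (intro sum_mono2) auto
  also have "\<dots> = (\<Sum>A\<in>Pow {..<N}. (\<Prod>i\<in>A. q) * (\<Prod>i\<in>{..<N} - A. 1 - q))"
    by (intro sum.cong refl) (auto simp: card_Diff_subset finite_subset)
  also have "\<dots> = (\<Prod>i\<in>{..<N}. q + (1 - q))"
    by (rule prod_add[symmetric]) simp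
  finally have "real (card ?\<A>) * exp (- (real N * entropy_fun q)) \<le> 1" by simp
  then show ?thesis by (simp add: exp_minus field_simps)
qed

section \<open>The Fourier transform as a product over scales\<close>

definition digit_fourier :: "nat \<Rightarrow> (nat \<Rightarrow> real) \<Rightarrow> (nat \<Rightarrow> real) \<Rightarrow> real \<Rightarrow> complex" where
  "digit_fourier m p t x = (\<Sum>i=1..m. of_real (p i) * iexp (2 * pi * x * t i))"

lemma summable_digit_expansion:
  fixes a :: real and t :: "nat \<Rightarrow> real"
  assumes a: "0 < a" "a < 1" and \<omega>: "\<And>n. \<omega> n \<in> {1..m::nat}"
  shows "summable (\<lambda>n. t (\<omega> n) * a ^ Suc n)"
proof -
  have bd: "norm (t (\<omega> n) * a ^ Suc n) \<le> ((\<Sum>i=1..m. \<bar>t i\<bar>) * a) * a ^ n" for n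
  proof -
    have "\<bar>t (\<omega> n)\<bar> \<le> (\<Sum>i=1..m. \<bar>t i\<bar>)"
      using \<omega>[of n] by (intro member_le_sum) auto
    then have "\<bar>t (\<omega> n)\<bar> * a ^ Suc n \<le> (\<Sum>i=1..m. \<bar>t i\<bar>) * a ^ Suc n"
      using a by (intro mult_right_mono) auto
    then show ?thesis using a by (simp add: abs_mult mult_ac)
  qed
  have "summable (\<lambda>n. ((\<Sum>i=1..m. \<bar>t i\<bar>) * a) * a ^ n)"
    using a by (intro summable_mult summable_geometric) simp
  then show ?thesis by (rule summable_comparison_test[rotated]) (use bd in blast)
qed

lemma prob_space_digits:
  assumes "prob_vector m p"
  shows "prob_space (point_measure {1..m} (\<lambda>i. ennreal (p i)))"
proof (rule prob_space_point_measure)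
  have "(\<Sum>i=1..m. ennreal (p i)) = ennreal (\<Sum>i=1..m. p i)"
    using assms by (intro sum_ennreal) (simp add: prob_vector_def)
  then show "(\<Sum>i=1..m. ennreal (p i)) = 1"
    using assms by (simp add: prob_vector_def)
qed simp_all

text \<open>
  Split off the first digit: shifting the digit sequence by one place turns the random sum \<open>X\<close> into
  \<open>a t + a X\<close> with the new first digit \<open>t\<close> independent of \<open>X\<close>.
\<close>
lemma fourier_self_similar_measure:
  fixes a u :: real and t :: "nat \<Rightarrow> real"
  assumes a: "0 < a" "a < 1" and p: "prob_vector m p"
  defines "\<mu> \<equiv> self_similar_measure a m p t"
  shows "fourier \<mu> u = digit_fourier m p t (a * u) * fourier \<mu> (a * u)"
proof -
  define M where "M = point_measure {1..m} (\<lambda>i. ennreal (p i))"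
  have spM: "space M = {1..m}" by (simp add: M_def space_point_measure)
  interpret M: prob_space M
    unfolding M_def using p by (rule prob_space_digits)
  interpret sequence_space M by unfold_locales
  define X where "X \<omega> = (\<Sum>n. t (\<omega> n) * a ^ Suc n)" for \<omega> :: "nat \<Rightarrow> nat"
  have t[measurable]: "t \<in> borel_measurable M"
    unfolding M_def by simp
  have X[measurable]: "X \<in> borel_measurable S"
    unfolding X_def by measurable
  have \<mu>: "\<mu> = distr S borel X"
    unfolding \<mu>_def self_similar_measure_def M_def X_def ..
  have fX: "fourier \<mu> v = (CLINT \<omega>|S. iexp (2 * pi * v * X \<omega>))" for v
    unfolding fourier_def \<mu> by (subst integral_distr) auto
  interpret MS: pair_prob_space M S ..
  have shift: "X (case_nat s \<omega>) = a * t s + a * X \<omega>" if "s \<in> space M" "\<omega> \<in> space S" for s \<omega>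
  proof -
    have \<omega>: "\<omega> n \<in> {1..m}" for n
      using that(2) spM by (auto simp: space_PiM PiE_def Pi_def)
    have s: "case_nat s \<omega> n \<in> {1..m}" for n
      using that(1) spM \<omega> by (auto split: nat.split)
    have "X (case_nat s \<omega>) = (\<Sum>n. t (case_nat s \<omega> (Suc n)) * a ^ Suc (Suc n)) + t (case_nat s \<omega> 0) * a ^ Suc 0"
      unfolding X_def using suminf_split_head[OF summable_digit_expansion[OF a, of "case_nat s \<omega>" m t]] s by auto
    also have "\<dots> = (\<Sum>n. a * (t (\<omega> n) * a ^ Suc n)) + a * t s"
      by (simp add: mult_ac)
    also have "(\<Sum>n. a * (t (\<omega> n) * a ^ Suc n)) = a * X \<omega>"
      unfolding X_def by (rule suminf_mult[OF summable_digit_expansion[OF a \<omega>]])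
    finally show ?thesis by simp
  qed
  have "fourier \<mu> u = (CLINT \<omega>|distr (M \<Otimes>\<^sub>M S) S (\<lambda>(s, \<omega>). case_nat s \<omega>). iexp (2 * pi * u * X \<omega>))"
    unfolding fX PiM_iter ..
  also have "\<dots> = (CLINT z|M \<Otimes>\<^sub>M S. iexp (2 * pi * u * X (case z of (s, \<omega>) \<Rightarrow> case_nat s \<omega>)))"
    by (rule integral_distr) measurable
  also have "\<dots> = (CLINT z|M \<Otimes>\<^sub>M S. (case z of (s, \<omega>) \<Rightarrow>
      iexp (2 * pi * (a * u) * t s) * iexp (2 * pi * (a * u) * X \<omega>)))"
    by (intro Bochner_Integration.integral_cong refl)
      (auto simp: space_pair_measure shift exp_add[symmetric] algebra_simps)
  also have "\<dots> = (CLINT s|M. (CLINT \<omega>|S. iexp (2 * pi * (a * u) * t s) * iexp (2 * pi * (a * u) * X \<omega>)))"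
  proof -
    have "integrable (M \<Otimes>\<^sub>M S) (\<lambda>(s, \<omega>). iexp (2 * pi * (a * u) * t s) * iexp (2 * pi * (a * u) * X \<omega>))"
      by (rule MS.P.integrable_const_bound[where B = 1]) (auto simp: norm_mult)
    from MS.integral_fst'[OF this] show ?thesis by simp
  qed
  also have "\<dots> = (CLINT s|M. iexp (2 * pi * (a * u) * t s)) * fourier \<mu> (a * u)"
    unfolding fX by simp
  also have "(CLINT s|M. iexp (2 * pi * (a * u) * t s)) = digit_fourier m p t (a * u)"
    unfolding M_def digit_fourier_def using p
    by (subst lebesgue_integral_point_measure_finite) (auto simp: prob_vector_def scaleR_conv_of_real)
  finally show ?thesis .
qed

lemma cmod_fourier_self_similar_measure_le_1:
  assumes p: "prob_vector m p"
  shows "cmod (fourier (self_similar_measure a m p t) u) \<le> 1"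
proof -
  define M where "M = point_measure {1..m} (\<lambda>i. ennreal (p i))"
  interpret M: prob_space M
    unfolding M_def using p by (rule prob_space_digits)
  interpret sequence_space M by unfold_locales
  have t[measurable]: "t \<in> borel_measurable M"
    unfolding M_def by simp
  have "prob_space (self_similar_measure a m p t)"
    unfolding self_similar_measure_def M_def[symmetric] by (rule prob_space_distr) measurable
  then interpret \<mu>: prob_space "self_similar_measure a m p t" .
  show ?thesis
    unfolding fourier_def
    using integral_norm_bound[of "self_similar_measure a m p t" "\<lambda>x. iexp (2 * pi * u * x)"] \<mu>.prob_space
    by simp
qed

lemma cmod_digit_fourier_le_1:
  assumes "prob_vector m p"
  shows "cmod (digit_fourier m p t x) \<le> 1"
proof -
  have "cmod (digit_fourier m p t x) \<le> (\<Sum>i=1..m. \<bar>p i\<bar>)"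
    unfolding digit_fourier_def by (rule order_trans[OF norm_sum]) (simp add: norm_mult)
  also have "\<dots> = 1" using assms by (simp add: prob_vector_def)
  finally show ?thesis .
qed

lemma cmod_fourier_le_prod:
  assumes a: "0 < a" "a < 1" and p: "prob_vector m p"
  shows "cmod (fourier (self_similar_measure a m p t) u) \<le>
           (\<Prod>j<N. cmod (digit_fourier m p t (a ^ (N - j) * u)))"
proof (induction N arbitrary: u)
  case 0
  then show ?case using cmod_fourier_self_similar_measure_le_1[OF p] by simp
next
  case (Suc N)
  have e: "a ^ (N - j) * (a * u) = a ^ (Suc N - j) * u" if "j < N" for j
    using that by (simp add: Suc_diff_le mult_ac)
  have "cmod (fourier (self_similar_measure a m p t) u)
      = cmod (digit_fourier m p t (a * u)) * cmod (fourier (self_similar_measure a m p t) (a * u))"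
    by (subst fourier_self_similar_measure[OF a p]) (simp add: norm_mult)
  also have "\<dots> \<le> cmod (digit_fourier m p t (a * u)) *
      (\<Prod>j<N. cmod (digit_fourier m p t (a ^ (N - j) * (a * u))))"
    using Suc.IH by (intro mult_left_mono) auto
  also have "\<dots> = (\<Prod>j<Suc N. cmod (digit_fourier m p t (a ^ (Suc N - j) * u)))"
    by (simp add: e)
  finally show ?case .
qed

section \<open>Decay away from the integers\<close>

lemma cos_le_if_not_near_int:
  assumes c: "0 \<le> c" and far: "\<not> near_int c x"
  shows "cos (2 * pi * x) \<le> cos (pi * c)"
proof -
  define y where "y = x - of_int (round x)"
  have y: "\<bar>y\<bar> \<le> 1 / 2" "c / 2 \<le> \<bar>y\<bar>"
    using of_int_round_abs_le[of x] far
    unfolding y_def near_int_def by (auto simp: abs_minus_commute not_less)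
  have "cos (2 * pi * x) = cos (2 * pi * y + 2 * pi * of_int (round x))"
    by (simp add: y_def algebra_simps)
  also have "\<dots> = cos (2 * pi * y)"
    by (simp add: cos_add sin_int_2pin cos_int_2pin)
  also have "\<dots> = cos (2 * pi * \<bar>y\<bar>)"
    by (cases "y \<ge> 0") auto
  also have "\<dots> \<le> cos (pi * c)"
    using y c by (intro cos_monotone_0_pi_le) (auto simp: mult_ac)
  finally show ?thesis .
qed

text \<open>
  The contribution \<open>p 1 + p 2 exp (2 pi i x)\<close> of the digits 0 and 1 has modulus
  \<open>sqrt ((p 1)\<^sup>2 + 2 p 1 p 2 cos (2 pi x) + (p 2)\<^sup>2)\<close>, and the remaining digits contribute at most
  their total weight \<open>1 - p 1 - p 2\<close>.
\<close>
lemma cmod_digit_fourier_le_eta: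
  assumes m: "2 \<le> m" and p: "prob_vector m p" and t: "t 1 = 0" "t 2 = 1"
    and c: "0 \<le> c" and far: "\<not> near_int c x"
  shows "cmod (digit_fourier m p t x) \<le> 1 - eta c p"
proof -
  let ?f = "\<lambda>i. of_real (p i) * iexp (2 * pi * x * t i)"
  let ?\<theta> = "2 * pi * x"
  have p_nonneg: "p i \<ge> 0" if "i \<in> {1..m}" for i using p that by (simp add: prob_vector_def)
  have p12: "p 1 \<ge> 0" "p 2 \<ge> 0" using p_nonneg m by auto
  have split: "(\<Sum>i=1..m. g i) = g 1 + g 2 + (\<Sum>i=3..m. g i)" for g :: "nat \<Rightarrow> 'b::comm_monoid_add"
  proof -
    have "{1..m} = insert 1 (insert 2 {3..m})" using m by auto
    then show ?thesis by (simp add: add.assoc)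
  qed
  have "(cmod (?f 1 + ?f 2))\<^sup>2 = (p 1 + p 2 * cos ?\<theta>)\<^sup>2 + (p 2 * sin ?\<theta>)\<^sup>2"
    using t by (simp only: cmod_power2) (simp add: Re_exp Im_exp del: One_nat_def)
  also have "\<dots> = (p 1)\<^sup>2 + 2 * p 1 * p 2 * cos ?\<theta> + (p 2)\<^sup>2 * ((cos ?\<theta>)\<^sup>2 + (sin ?\<theta>)\<^sup>2)"
    by algebra
  also have "\<dots> \<le> (p 1)\<^sup>2 + 2 * p 1 * p 2 * cos (pi * c) + (p 2)\<^sup>2"
    using cos_le_if_not_near_int[OF c far] p12 by (simp add: mult_left_mono)
  finally have first_two: "cmod (?f 1 + ?f 2) \<le> sqrt ((p 1)\<^sup>2 + 2 * p 1 * p 2 * cos (pi * c) + (p 2)\<^sup>2)"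
    by (rule real_le_rsqrt)
  have "cmod (\<Sum>i=3..m. ?f i) \<le> (\<Sum>i=3..m. p i)"
    using p_nonneg by (intro sum_norm_le) (simp add: norm_mult)
  also have "\<dots> = 1 - p 1 - p 2"
    using p split[of p] by (simp add: prob_vector_def)
  finally have "cmod (\<Sum>i=3..m. ?f i) \<le> 1 - p 1 - p 2" .
  then show ?thesis
    unfolding digit_fourier_def split[of ?f] eta_def
    using first_two norm_triangle_ineq[of "?f 1 + ?f 2" "\<Sum>i=3..m. ?f i"] by linarith
qed

lemma eta_between_0_1:
  assumes m: "2 \<le> m" and p: "prob_vector m p" and pos: "\<forall>i\<in>{1..m}. p i > 0"
    and c: "0 < c" "c < 1"
  shows "0 < eta c p" "eta c p < 1"
proof -
  have p12: "p 1 > 0" "p 2 > 0" using pos m by auto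
  have "p 1 + p 2 \<le> 1"
  proof -
    have "(\<Sum>i\<in>{1,2}. p i) \<le> (\<Sum>i=1..m. p i)"
      using m p by (intro sum_mono2) (auto simp: prob_vector_def)
    then show ?thesis using p by (simp add: prob_vector_def)
  qed
  have "cos (pi * c) < cos 0" and "cos pi < cos (pi * c)"
    using c by (auto intro!: cos_monotone_0_pi simp del: cos_zero cos_pi)
  then have cos: "-1 < cos (pi * c)" "cos (pi * c) < 1" by simp_all
  let ?w = "(p 1)\<^sup>2 + 2 * p 1 * p 2 * cos (pi * c) + (p 2)\<^sup>2"
  have "?w < (p 1)\<^sup>2 + 2 * p 1 * p 2 * 1 + (p 2)\<^sup>2"
    using p12 cos by simp
  also have "\<dots> = (p 1 + p 2)\<^sup>2" by (simp add: power2_eq_square algebra_simps)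
  finally have "sqrt ?w < p 1 + p 2" using p12 by (intro real_less_lsqrt) auto
  then show "0 < eta c p" by (simp add: eta_def)
  have "0 \<le> (p 1 - p 2)\<^sup>2" by simp
  also have "\<dots> = (p 1)\<^sup>2 + 2 * p 1 * p 2 * (-1) + (p 2)\<^sup>2" by (simp add: power2_eq_square algebra_simps)
  also have "\<dots> < ?w" using p12 cos by (intro add_strict_right_mono add_strict_left_mono mult_strict_left_mono) auto
  finally have "sqrt ?w > 0" by simp
  with \<open>p 1 + p 2 \<le> 1\<close> show "eta c p < 1" unfolding eta_def by linarith
qed

text \<open>
  Every bad scale contributes a factor at most \<open>\<rho>\<close> and every other scale a factor at most 1, so
  \<open>T powr (- \<epsilon>) \<le> \<rho> ^ b\<close> for the number \<open>b\<close> of bad scales; take logarithms.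
\<close>
lemma few_bad_scales:
  assumes a: "0 < a" "a < 1" and p: "prob_vector m p"
    and \<rho>: "0 < \<rho>" "\<rho> < 1"
    and decay: "\<And>x. \<not> near_int c x \<Longrightarrow> cmod (digit_fourier m p t x) \<le> \<rho>"
    and T: "0 < T"
    and large: "T powr (- \<epsilon>) \<le> cmod (fourier (self_similar_measure a m p t) u)"
  shows "real (card {j. j < N \<and> \<not> near_int c (a ^ (N - j) * u)}) \<le> \<epsilon> * ln T / - ln \<rho>"
proof -
  let ?B = "{j. j < N \<and> \<not> near_int c (a ^ (N - j) * u)}"
  let ?f = "\<lambda>j. cmod (digit_fourier m p t (a ^ (N - j) * u))"
  have "T powr (- \<epsilon>) \<le> (\<Prod>j<N. ?f j)"
    using large cmod_fourier_le_prod[OF a p] by (rule order_trans)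
  also have "\<dots> \<le> (\<Prod>j<N. if j \<in> ?B then \<rho> else 1)"
    using decay cmod_digit_fourier_le_1[OF p] by (intro prod_mono) auto
  also have "\<dots> = (\<Prod>j\<in>{..<N} \<inter> ?B. \<rho>)"
    by (simp only: prod.inter_restrict[symmetric] finite_lessThan)
  also have "{..<N} \<inter> ?B = ?B" by auto
  finally have "T powr (- \<epsilon>) \<le> \<rho> ^ card ?B" by simp
  then have "ln (T powr (- \<epsilon>)) \<le> ln (\<rho> ^ card ?B)"
    using \<rho> T by (subst ln_le_cancel_iff) auto
  then have "- \<epsilon> * ln T \<le> real (card ?B) * ln \<rho>"
    using \<rho> T by (simp add: ln_powr ln_realpow)
  then have "real (card ?B) * - ln \<rho> \<le> \<epsilon> * ln T" by simp
  moreover have "- ln \<rho> > 0" using \<rho> by simp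
  ultimately show ?thesis by (simp only: pos_le_divide_eq)
qed

section \<open>The covering of the large frequencies\<close>

text \<open>
  The upper bound is crude but enough to absorb the rounding of the number of scales into the
  constant: it comes from \<open>- x ln x = x ln (1 / x) \<le> x (1 / x - 1) = 1 - x\<close>, applied to \<open>q\<close> and
  \<open>1 - q\<close>.
\<close>
lemma entropy_fun_bounds:
  assumes "0 < q" "q < 1"
  shows "0 \<le> entropy_fun q" "entropy_fun q \<le> 1"
proof -
  have bd: "0 \<le> - x * ln x \<and> - x * ln x \<le> 1 - x" if "0 < x" "x < 1" for x :: real
  proof -
    have "- ln x \<le> 1 / x - 1"
      using ln_le_minus_one[of "1 / x"] that by (simp add: ln_div)
    then have "x * - ln x \<le> x * (1 / x - 1)"
      using that by (intro mult_left_mono) auto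
    also have "\<dots> = 1 - x" using that by (simp add: right_diff_distrib)
    finally have "- x * ln x \<le> 1 - x" by simp
    moreover have "x * ln x \<le> 0"
      using that by (intro mult_nonneg_nonpos) auto
    ultimately show ?thesis by simp
  qed
  have "entropy_fun q = - q * ln q + - (1 - q) * ln (1 - q)"
    by (simp add: entropy_fun_def algebra_simps)
  moreover have "0 < 1 - q" "1 - q < 1" using assms by simp_all
  ultimately show "0 \<le> entropy_fun q" "entropy_fun q \<le> 1"
    using bd[OF assms] bd[of "1 - q"] by linarith+
qed

lemma covered_by_length_imp_unit_intervals:
  assumes "covered_by_length l S b" "l \<le> 1"
  shows "covered_by_unit_intervals S b"
proof -
  obtain F where F: "finite F" "real (card F) \<le> b" "S \<subseteq> (\<Union>x\<in>F. {x..x + l})"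
    using assms(1) unfolding covered_by_length_def by blast
  let ?I = "(\<lambda>x. {x..x + 1}) ` F"
  have "real (card ?I) \<le> b"
    using card_image_le[OF F(1), of "\<lambda>x. {x..x + 1}"] F(2) by linarith
  moreover have "(\<Union>x\<in>F. {x..x + l}) \<subseteq> \<Union>?I"
    using assms(2) by fastforce
  ultimately show ?thesis
    unfolding covered_by_unit_intervals_def using F by (intro exI[of _ ?I]) auto
qed

text \<open>
  The union over all sets \<open>A\<close> of at most \<open>q L\<close> bad scales: each \<open>A\<close> costs at most
  \<open>4 D powr (q L)\<close> intervals with \<open>D = \<lceil>1 + 1 / a\<rceil>\<close>, and there are at most \<open>exp (N h(q))\<close> such
  sets. As \<open>T = exp (L ln (1 / a))\<close>, the product is a power of \<open>T\<close> with the exponent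
  \<open>cover_exponent a p \<epsilon>\<close>, up to the constant.
\<close>
lemma large_frequencies_covered:
  fixes a T \<epsilon> :: real
  defines "c \<equiv> a / (a + 1)"
  assumes a: "0 < a" "a < 1" and m: "2 \<le> m" and p: "prob_vector m p"
    and pos: "\<forall>i\<in>{1..m}. p i > 0" and t: "t 1 = 0" "t 2 = 1"
    and T: "1 \<le> T" and q: "0 < eps_tilde a p \<epsilon>" "eps_tilde a p \<epsilon> \<le> 1 / 2"
  shows "covered_by_unit_intervals
           {u \<in> {-T..T}. T powr (- \<epsilon>) \<le> cmod (fourier (self_similar_measure a m p t) u)}
           (4 * exp 1 * T powr cover_exponent a p \<epsilon>)"
proof -
  define \<rho> where "\<rho> = 1 - eta c p"
  define q where "q = eps_tilde a p \<epsilon>"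
  define L where "L = ln T / ln (1 / a)"
  define N where "N = nat \<lceil>L\<rceil>"
  define l where "l = 1 / (a + 1)"
  define D where "D = real (nat \<lceil>1 + 1 / a\<rceil>)"
  define \<A> where "\<A> = {A. A \<subseteq> {..<N} \<and> real (card A) \<le> q * L}"
  define S where
    "S A = {u. \<bar>a ^ N * u\<bar> \<le> 1 \<and> (\<forall>j<N. j \<notin> A \<longrightarrow> near_int c (a ^ (N - j) * u))}" for A
  have c: "0 < c" "c < 1" using a by (auto simp: c_def)
  have \<rho>: "0 < \<rho>" "\<rho> < 1" using eta_between_0_1[OF m p pos c] by (auto simp: \<rho>_def)
  have q_eq: "q = ln a / ln \<rho> * \<epsilon>" by (simp add: q_def eps_tilde_def \<rho>_def c_def)
  have q01: "0 < q" "q \<le> 1 / 2" using q by (simp_all add: q_def)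
  have ln_a: "ln (1 / a) > 0" "ln a < 0" using a by simp_all
  have ln_T: "ln T = L * ln (1 / a)" using ln_a by (simp add: L_def)
  have L: "0 \<le> L" using T ln_a by (simp add: L_def)
  have N: "L \<le> real N" "real N \<le> L + 1" using L unfolding N_def by linarith+
  have "1 \<le> \<lceil>1 + 1 / a\<rceil>" using a by (simp add: add_pos_pos)
  then have D: "1 \<le> D" "D = of_int \<lceil>1 + 1 / a\<rceil>" by (simp_all add: D_def)
  have aNT: "a ^ N * T \<le> 1"
  proof -
    have "ln (a ^ N * T) = L * ln (1 / a) - real N * ln (1 / a)"
      using a T by (simp add: ln_mult ln_realpow ln_div ln_T)
    also have "\<dots> \<le> 0" using N(1) ln_a by (simp add: mult_right_mono)
    finally show ?thesis using a T by (simp add: ln_le_zero_iff)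
  qed
  have "{u \<in> {-T..T}. T powr (- \<epsilon>) \<le> cmod (fourier (self_similar_measure a m p t) u)} \<subseteq> (\<Union>A\<in>\<A>. S A)"
  proof
    fix u
    assume u: "u \<in> {u \<in> {-T..T}. T powr (- \<epsilon>) \<le> cmod (fourier (self_similar_measure a m p t) u)}"
    let ?B = "{j. j < N \<and> \<not> near_int c (a ^ (N - j) * u)}"
    have "real (card ?B) \<le> \<epsilon> * ln T / - ln \<rho>"
      using cmod_digit_fourier_le_eta[OF m p t less_imp_le[OF c(1)]] u T
      by (intro few_bad_scales[OF a p \<rho>]) (auto simp: \<rho>_def)
    also have "\<dots> = q * L"
      using ln_a \<rho> a by (simp add: q_eq L_def ln_div field_simps)
    finally have "?B \<in> \<A>" by (auto simp: \<A>_def)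
    moreover have "u \<in> S ?B"
    proof -
      have "\<bar>a ^ N * u\<bar> = a ^ N * \<bar>u\<bar>" using a by (simp add: abs_mult)
      also have "\<dots> \<le> a ^ N * T" using a u by (intro mult_left_mono) auto
      finally show ?thesis using aNT by (auto simp: S_def)
    qed
    ultimately show "u \<in> (\<Union>A\<in>\<A>. S A)" by blast
  qed
  moreover have "covered_by_length l (\<Union>A\<in>\<A>. S A) (\<Sum>A\<in>\<A>. 4 * D powr (q * L))"
  proof (rule covered_by_length_UN)
    show "finite \<A>" by (rule finite_subset[of _ "Pow {..<N}"]) (auto simp: \<A>_def)
    fix A assume A: "A \<in> \<A>"
    have l: "c = a * l" "c + l = 1" "1 / 2 < l" using a by (auto simp: c_def l_def field_simps)
    have "covered_by_length l (S A) (4 * D ^ card (A \<inter> {..<N}))"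
      unfolding S_def D_def by (rule frequencies_with_bad_scales_covered[OF a(1) l])
    moreover have "A \<inter> {..<N} = A" using A by (auto simp: \<A>_def)
    moreover have "D ^ card A \<le> D powr (q * L)"
      using A D(1) by (simp add: \<A>_def powr_realpow[symmetric] powr_mono)
    ultimately show "covered_by_length l (S A) (4 * D powr (q * L))"
      by (simp add: covered_by_length_mono[OF _ order_refl])
  qed
  moreover have "(\<Sum>A\<in>\<A>. 4 * D powr (q * L)) \<le> 4 * exp 1 * T powr cover_exponent a p \<epsilon>"
  proof -
    let ?h = "entropy_fun q"
    have h: "0 \<le> ?h" "?h \<le> 1" using entropy_fun_bounds q01 by simp_all
    have "q * L \<le> q * real N" using N(1) q01 by (intro mult_left_mono) auto
    then have "\<A> \<subseteq> {A. A \<subseteq> {..<N} \<and> real (card A) \<le> q * real N}"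
      unfolding \<A>_def by (auto intro: order_trans)
    then have "card \<A> \<le> card {A. A \<subseteq> {..<N} \<and> real (card A) \<le> q * real N}"
      by (intro card_mono finite_subset[of "{A. A \<subseteq> {..<N} \<and> real (card A) \<le> q * real N}" "Pow {..<N}"]) auto
    then have "real (card \<A>) \<le> exp (real N * ?h)"
      using card_small_subsets_le_entropy[OF q01, of N] by linarith
    also have "\<dots> \<le> exp (L * ?h + 1)"
      using mult_right_mono[OF N(2) h(1)] h(2) by (simp add: distrib_right)
    finally have "(\<Sum>A\<in>\<A>. 4 * D powr (q * L)) \<le> exp (L * ?h + 1) * (4 * D powr (q * L))"
      by (simp add: mult_right_mono)
    also have "\<dots> = 4 * exp 1 * exp (L * (ln D * q + ?h))"
      using D(1) by (simp add: powr_def exp_add algebra_simps)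
    also have "L * (ln D * q + ?h) = cover_exponent a p \<epsilon> * ln T"
      using ln_a by (simp add: cover_exponent_def q_def D(2) L_def)
    also have "exp \<dots> = T powr cover_exponent a p \<epsilon>"
      using T by (simp add: powr_def)
    finally show ?thesis .
  qed
  ultimately have "covered_by_length l
      {u \<in> {-T..T}. T powr (- \<epsilon>) \<le> cmod (fourier (self_similar_measure a m p t) u)}
      (4 * exp 1 * T powr cover_exponent a p \<epsilon>)"
    using covered_by_length_mono by blast
  moreover have "l \<le> 1" using a by (simp add: l_def)
  ultimately show ?thesis by (rule covered_by_length_imp_unit_intervals)
qed

lemma continuous_on_smallness_threshold:
  assumes m: "2 \<le> m" and p: "prob_vector m p" and pos: "\<forall>i\<in>{1..m}. p i > 0"
  shows "continuous_on {0<..<1} (\<lambda>a. ln (1 - eta (a / (a + 1)) p) / ln a / 2)"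
proof -
  have eta: "eta (a / (a + 1)) p < 1" if "a \<in> {0<..<1}" for a
    using that by (intro eta_between_0_1[OF m p pos]) auto
  have "continuous_on {0<..<1} (\<lambda>a. eta (a / (a + 1)) p)"
    unfolding eta_def by (intro continuous_intros) auto
  then show ?thesis
    using eta by (intro continuous_intros) force+
qed

theorem proposition2p3:
  "\<exists>C :: real \<Rightarrow> real. (\<forall>a\<in>{0<..<1}. C a > 0) \<and>
     (\<forall>(m::nat) (p::nat \<Rightarrow> real). m \<ge> 2 \<and> prob_vector m p \<and> (\<forall>i\<in>{1..m}. p i > 0) \<longrightarrow>
       (\<exists>\<epsilon>0 :: real \<Rightarrow> real. continuous_on {0<..<1} \<epsilon>0 \<and> (\<forall>a\<in>{0<..<1}. \<epsilon>0 a > 0) \<and>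
         (\<forall>a\<in>{0<..<1}. \<forall>t::nat \<Rightarrow> real. t 1 = 0 \<and> t 2 = 1 \<longrightarrow>
           (\<forall>\<epsilon>. 0 < \<epsilon> \<and> \<epsilon> < \<epsilon>0 a \<longrightarrow>
             (\<forall>\<^sub>F T in at_top.
               covered_by_unit_intervals
                 {u \<in> {-T..T}. cmod (fourier (self_similar_measure a m p t) u) \<ge> T powr (- \<epsilon>)}
                 (C a * T powr cover_exponent a p \<epsilon>))))))"
proof (rule exI[of _ "\<lambda>_. 4 * exp 1"], intro conjI allI impI)
  show "\<forall>a\<in>{0<..<1}. (0::real) < 4 * exp 1" by simp
next
  fix m :: nat and p :: "nat \<Rightarrow> real"
  assume H: "2 \<le> m \<and> prob_vector m p \<and> (\<forall>i\<in>{1..m}. 0 < p i)"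
  \<comment> \<open>The value of \<open>\<epsilon>\<close> at which \<open>eps_tilde a p \<epsilon>\<close> equals \<open>1 / 2\<close>.\<close>
  let ?\<epsilon>0 = "\<lambda>a::real. ln (1 - eta (a / (a + 1)) p) / ln a / 2"
  have ln_\<rho>: "ln (1 - eta (a / (a + 1)) p) < 0" if "a \<in> {0<..<1}" for a
  proof -
    have "0 < a / (a + 1)" "a / (a + 1) < 1" using that by auto
    then show ?thesis using eta_between_0_1[of m p "a / (a + 1)"] H by simp
  qed
  show "\<exists>\<epsilon>0. continuous_on {0<..<1} \<epsilon>0 \<and> (\<forall>a\<in>{0<..<1}. \<epsilon>0 a > 0) \<and>
         (\<forall>a\<in>{0<..<1}. \<forall>t::nat \<Rightarrow> real. t 1 = 0 \<and> t 2 = 1 \<longrightarrow>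
           (\<forall>\<epsilon>. 0 < \<epsilon> \<and> \<epsilon> < \<epsilon>0 a \<longrightarrow>
             (\<forall>\<^sub>F T in at_top.
               covered_by_unit_intervals
                 {u \<in> {-T..T}. cmod (fourier (self_similar_measure a m p t) u) \<ge> T powr (- \<epsilon>)}
                 (4 * exp 1 * T powr cover_exponent a p \<epsilon>))))"
  proof (rule exI[of _ ?\<epsilon>0], intro conjI ballI allI impI)
    show "continuous_on {0<..<1} ?\<epsilon>0"
      using H by (intro continuous_on_smallness_threshold) auto
  next
    fix a :: real assume "a \<in> {0<..<1}"
    then show "0 < ?\<epsilon>0 a" using ln_\<rho>[of a] by (auto intro: divide_neg_neg)
  next
    fix a \<epsilon> :: real and t :: "nat \<Rightarrow> real"
    assume a: "a \<in> {0<..<1}" and t: "t 1 = 0 \<and> t 2 = 1" and \<epsilon>: "0 < \<epsilon> \<and> \<epsilon> < ?\<epsilon>0 a"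
    have ln_a: "ln a < 0" using a by simp
    have q: "0 < eps_tilde a p \<epsilon>" "eps_tilde a p \<epsilon> \<le> 1 / 2"
    proof -
      have r: "0 < ln a / ln (1 - eta (a / (a + 1)) p)"
        using ln_a ln_\<rho>[OF a] by (rule divide_neg_neg)
      then show "0 < eps_tilde a p \<epsilon>" using \<epsilon> unfolding eps_tilde_def by (intro mult_pos_pos) auto
      have "eps_tilde a p \<epsilon> \<le> ln a / ln (1 - eta (a / (a + 1)) p) * ?\<epsilon>0 a"
        unfolding eps_tilde_def using \<epsilon> r by (intro mult_left_mono) auto
      also have "\<dots> = 1 / 2" using ln_a ln_\<rho>[OF a] by simp
      finally show "eps_tilde a p \<epsilon> \<le> 1 / 2" .
    qed
    show "\<forall>\<^sub>F T in at_top. covered_by_unit_intervals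
        {u \<in> {-T..T}. cmod (fourier (self_similar_measure a m p t) u) \<ge> T powr (- \<epsilon>)}
        (4 * exp 1 * T powr cover_exponent a p \<epsilon>)"
      using eventually_ge_at_top[of "1::real"]
    proof eventually_elim
      case (elim T)
      then show ?case
        using large_frequencies_covered[of a m p t T \<epsilon>] a H t q by simp
    qed
  qed
qed

end
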